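(* For every finite abelian group $G$ we have $d_{\min}(G)=\operatorname{rk}(G)$.
   Context: For a finite abelian group $G$ with $n=|G|$, let $\mathcal C(G)$ be the set of Hamiltonian cycles in the complete digraph on vertex set $G$; a cycle is written $C=(g_1,\ldots,g_n)$, a listing of all elements of $G$, with directed edges $(g_i,g_{i+1})$, indices taken modulo $n$. Let $D(C)=\{g_{i+1}-g_i : 1\le i\le n\}$ (indices mod $n$) be the set of differences along $C$, and $d_{\min}(G)=\min\{|D(C)| : C\in\mathcal C(G)\}$, with the convention $\min\varnothing=0$ (so $d_{\min}(G)=0$ for trivial $G$). $\operatorname{rk}(G)$ denotes the rank of $G$, i.e. the minimum number of generators. *)

theory Defs
  imports "HOL-Algebra.Algebra"
begin

definition complete_digraph_arcs :: "'a set \<Rightarrow> ('a \<times> 'a) set"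
  where "complete_digraph_arcs V = {(u, v). u \<in> V \<and> v \<in> V \<and> u \<noteq> v}"

definition cycle_arcs :: "'a list \<Rightarrow> ('a \<times> 'a) set"
  where "cycle_arcs xs = {(xs ! i, xs ! (Suc i mod length xs)) | i. i < length xs}"

(* A Hamiltonian cycle is given by a listing of the vertices, so its rotations count as separate
   listings; they have the same arcs. The complete digraph is loopless, so there is none on a
   single vertex, while (g, h) is one on two vertices. *)
definition hamiltonian_cycles :: "('a, 'b) monoid_scheme \<Rightarrow> 'a list set"
  where "hamiltonian_cycles G = {xs. distinct xs \<and> set xs = carrier G \<and>
           cycle_arcs xs \<subseteq> complete_digraph_arcs (carrier G)}"

(* HOL-Algebra groups are written multiplicatively: h \<otimes> inv g is the difference h - g. *)
definition differences :: "('a, 'b) monoid_scheme \<Rightarrow> 'a list \<Rightarrow> 'a set"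
  where "differences G xs = {h \<otimes>\<^bsub>G\<^esub> inv\<^bsub>G\<^esub> g | g h. (g, h) \<in> cycle_arcs xs}"

definition d_min :: "('a, 'b) monoid_scheme \<Rightarrow> nat"
  where "d_min G = (if hamiltonian_cycles G = {} then 0
           else LEAST k. \<exists>xs \<in> hamiltonian_cycles G. k = card (differences G xs))"

(* LEAST is only meaningful for finitely generated G. *)
definition group_rank :: "('a, 'b) monoid_scheme \<Rightarrow> nat"
  where "group_rank G =
           (LEAST k. \<exists>S. S \<subseteq> carrier G \<and> finite S \<and> card S = k \<and> generate G S = carrier G)"

end

theory Submission
  imports Defs
begin

text \<open>The differences along a Hamiltonian cycle generate the group, so there are at least
  \<open>rk G\<close> of them. Conversely, let a group be generated by \<open>k\<close> elements, and among all generating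
  \<open>k\<close>-families choose one containing an element \<open>s\<close> of least possible order \<open>m\<close>. Then the
  subgroup \<open>H\<close> generated by the other \<open>k - 1\<close> elements meets \<open>\<langle>s\<rangle>\<close> trivially (Rado). If
  \<open>h\<^sub>0, \<dots>, h\<^sub>n\<^sub>-\<^sub>1\<close> lists \<open>H\<close>, then the elements \<open>h\<^sub>i + j s\<close>, ordered lexicographically by \<open>(j, i)\<close>,
  list the whole group; all steps between consecutive blocks, and the step that closes the cycle,
  have the same difference \<open>h\<^sub>0 + s - h\<^sub>n\<^sub>-\<^sub>1\<close>. So each generator costs only one new difference.\<close>

section \<open>Powers and finite products\<close>

lemma (in group) subgroup_nat_pow_closed:
  fixes n :: nat
  assumes "subgroup H G" "h \<in> H"
  shows "h [^] n \<in> H"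
  using assms by (induction n) (auto simp: subgroup.one_closed subgroup.m_closed)

lemma (in group) pow_mod_ord:
  fixes n :: nat
  assumes "a \<in> carrier G"
  shows "a [^] (n mod ord a) = a [^] n"
proof -
  have "a [^] n = a [^] (ord a * (n div ord a) + n mod ord a)" by simp
  also have "\<dots> = (a [^] ord a) [^] (n div ord a) \<otimes> a [^] (n mod ord a)"
    using assms by (simp only: nat_pow_mult nat_pow_pow nat_pow_closed)
  finally show ?thesis using assms by simp
qed

context comm_group
begin

lemma finprod_in_subgroup:
  assumes H: "subgroup H G" and "\<And>i. i \<in> I \<Longrightarrow> f i \<in> H"
  shows "finprod G f I \<in> H"
  using assms(2)
proof (induction I rule: infinite_finite_induct)
  case (insert i I)
  then have "f \<in> I \<rightarrow> carrier G" "f i \<in> carrier G" using subgroup.mem_carrier[OF H] by auto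
  then show ?case using insert H by (simp add: subgroup.m_closed)
qed (use H in \<open>simp_all add: subgroup.one_closed\<close>)

lemma finprod_remove:
  assumes "finite I" "i \<in> I" "f \<in> I \<rightarrow> carrier G"
  shows "finprod G f I = f i \<otimes> finprod G f (I - {i})"
proof -
  have "finprod G f (insert i (I - {i})) = f i \<otimes> finprod G f (I - {i})"
    using assms by (intro finprod_insert) auto
  then show ?thesis using assms by (simp add: insert_absorb)
qed

section \<open>Exchanging generators and shrinking relations\<close>

text \<open>The exchange is reversible: as \<open>i\<close> and \<open>j\<close> differ, the member
  at \<open>j\<close> is unchanged, and multiplying the new member at \<open>i\<close> by its
  inverse recovers \<open>x i\<close>.\<close>

lemma generate_image_mult_update:
  assumes x: "x \<in> I \<rightarrow> carrier G" and i: "i \<in> I" and j: "j \<in> I" and ij: "i \<noteq> j"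
  shows "generate G (x(i := x i \<otimes> x j) ` I) = generate G (x ` I)"
proof -
  let ?y = "x(i := x i \<otimes> x j)"
  have y: "?y \<in> I \<rightarrow> carrier G" using x i j by (auto simp: Pi_iff)
  have cx: "x ` I \<subseteq> carrier G" and cy: "?y ` I \<subseteq> carrier G" using x y by blast+
  have sx: "subgroup (generate G (x ` I)) G" and sy: "subgroup (generate G (?y ` I)) G"
    using cx cy generate_is_subgroup by blast+
  have xin: "x l \<in> generate G (x ` I)" if "l \<in> I" for l
    using that by (blast intro: generate.incl)
  have yin: "?y l \<in> generate G (?y ` I)" if "l \<in> I" for l
    using that by (blast intro: generate.incl)
  have "?y ` I \<subseteq> generate G (x ` I)"
    using xin i j subgroup.m_closed[OF sx] by auto
  moreover have "x ` I \<subseteq> generate G (?y ` I)"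
  proof
    fix z assume "z \<in> x ` I"
    then obtain l where l: "l \<in> I" "z = x l" by blast
    show "z \<in> generate G (?y ` I)"
    proof (cases "l = i")
      case True
      have "?y i \<otimes> inv (?y j) \<in> generate G (?y ` I)"
        using sy yin i j by (meson subgroup.m_closed subgroup.m_inv_closed)
      moreover have "?y i \<otimes> inv (?y j) = x i"
        using x i j ij by (simp add: m_assoc Pi_def)
      ultimately show ?thesis using True l by simp
    next
      case False
      then show ?thesis using yin[OF l(1)] l by simp
    qed
  qed
  ultimately show ?thesis
    using generate_subgroup_incl[OF _ sx] generate_subgroup_incl[OF _ sy] by blast
qed

text \<open>One Euclidean step, in additive notation: m_i x_i + m_j x_j = m_i (x_i + x_j) + (m_j -
  m_i) x_j. The assumption \<open>le\<close> makes the subtraction of natural numbers a true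
  one.\<close>

lemma finprod_pow_mult_update:
  fixes m :: "'i \<Rightarrow> nat"
  assumes fin: "finite I" and x: "x \<in> I \<rightarrow> carrier G" and i: "i \<in> I" and j: "j \<in> I"
    and ij: "i \<noteq> j" and le: "m i \<le> m j"
  shows "finprod G (\<lambda>l. (x(i := x i \<otimes> x j)) l [^] (m(j := m j - m i)) l) I
       = finprod G (\<lambda>l. x l [^] m l) I"
proof -
  let ?y = "x(i := x i \<otimes> x j)" and ?k = "m(j := m j - m i)"
  let ?f = "\<lambda>l. x l [^] m l" and ?g = "\<lambda>l. ?y l [^] ?k l"
  have c: "x i \<in> carrier G" "x j \<in> carrier G" using x i j by auto
  have f: "?f \<in> I \<rightarrow> carrier G" and g: "?g \<in> I \<rightarrow> carrier G"
    using x c by (auto simp: Pi_def)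
  have split: "finprod G h I = h i \<otimes> (h j \<otimes> finprod G h (I - {i} - {j}))"
    if "h \<in> I \<rightarrow> carrier G" for h
    using that fin i j ij by (subst finprod_remove[of I i], simp_all, subst finprod_remove[of _ j], auto)
  let ?r = "finprod G ?f (I - {i} - {j})"
  have r: "?r \<in> carrier G" using f by (intro finprod_closed) auto
  have "?r = finprod G ?g (I - {i} - {j})"
    using f by (intro finprod_cong') (auto simp: Pi_def)
  moreover have "?g i = x i [^] m i \<otimes> x j [^] m i"
    using c ij by (simp add: pow_mult_distrib m_comm)
  moreover have "?g j = x j [^] (m j - m i)" using ij by simp
  moreover have "x j [^] m i \<otimes> x j [^] (m j - m i) = x j [^] m j"
    using c le by (simp add: nat_pow_mult)
  ultimately show ?thesis
    unfolding split[OF f] split[OF g] using c r by (simp add: m_assoc flip: m_assoc[of "x j [^] m i"])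
qed

text \<open>The Euclidean algorithm on the exponents, mirrored by exchanges of generators, reduces a
  relation to one of the form \<open>m i x i = 0\<close>.\<close>
lemma relation_exponent_ge_min_ord:
  fixes m :: "'i \<Rightarrow> nat"
  assumes fin: "finite I"
    and min: "\<And>y i. \<lbrakk>y \<in> I \<rightarrow> carrier G; generate G (y ` I) = H; i \<in> I\<rbrakk> \<Longrightarrow> N \<le> ord (y i)"
    and "x \<in> I \<rightarrow> carrier G" "generate G (x ` I) = H"
    and "finprod G (\<lambda>l. x l [^] m l) I = \<one>" and "i \<in> I" "0 < m i"
  shows "N \<le> m i"
  using assms(3-)
proof (induction "sum m I" arbitrary: x m i rule: less_induct)
  case less
  note x = less.prems(1) and H = less.prems(2) and rel = less.prems(3)
    and i = less.prems(4) and mi = less.prems(5)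
  \<comment> \<open>The sum of the exponents is the measure of the induction; it drops because the
    subtracted exponent is positive.\<close>
  have sum_less: "sum (m(b := m b - m a)) I < sum m I" if "b \<in> I" "0 < m a" "m a \<le> m b" for a b
    using that fin by (intro sum_strict_mono_ex1) auto
  show ?case
  proof (cases "\<exists>j\<in>I - {i}. 0 < m j")
    case False
    \<comment> \<open>All other exponents vanish, so the relation reads
      \<open>x i [^] m i = \<one>\<close> and bounds \<open>m i\<close> below by an order.\<close>
    have "finprod G (\<lambda>l. x l [^] m l) I = x i [^] m i \<otimes> finprod G (\<lambda>l. x l [^] m l) (I - {i})"
      using fin i x by (intro finprod_remove) (auto simp: Pi_def)
    also have "finprod G (\<lambda>l. x l [^] m l) (I - {i}) = \<one>"
      using False by (intro finprod_one_eqI) auto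
    finally have "x i [^] m i = \<one>" using rel i x by (auto simp: Pi_def)
    then have "ord (x i) dvd m i" using i x by (auto intro: pow_eq_id[THEN iffD1])
    then have "ord (x i) \<le> m i" using mi by (rule dvd_imp_le)
    then show ?thesis using min[OF x H i] by linarith
  next
    case True
    then obtain j where j: "j \<in> I" "j \<noteq> i" "0 < m j" by blast
    show ?thesis
    proof (cases "m i \<le> m j")
      case True
      \<comment> \<open>The exponent at \<open>j\<close> may drop to 0, so the induction hypothesis
        is applied at \<open>i\<close>, whose exponent stays the same.\<close>
      have "N \<le> (m(j := m j - m i)) i"
      proof (rule less.hyps[OF sum_less[OF j(1) mi True]])
        show "x(i := x i \<otimes> x j) \<in> I \<rightarrow> carrier G" using x i j by (auto simp: Pi_iff)
        show "generate G (x(i := x i \<otimes> x j) ` I) = H"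
          using generate_image_mult_update[OF x i j(1)] j H by simp
        show "finprod G (\<lambda>l. (x(i := x i \<otimes> x j)) l [^] (m(j := m j - m i)) l) I = \<one>"
          using finprod_pow_mult_update[OF fin x i j(1) _ True] j rel by simp
      qed (use i j mi in auto)
      then show ?thesis using j by simp
    next
      case False
      then have le: "m j \<le> m i" by simp
      \<comment> \<open>Now \<open>j\<close> keeps its positive exponent; applying the induction
        hypothesis there gives \<open>N \<le> m j \<le> m i\<close>.\<close>
      have "N \<le> (m(i := m i - m j)) j"
      proof (rule less.hyps[OF sum_less[OF i j(3) le]])
        show "x(j := x j \<otimes> x i) \<in> I \<rightarrow> carrier G" using x i j by (auto simp: Pi_iff)
        show "generate G (x(j := x j \<otimes> x i) ` I) = H"
          using generate_image_mult_update[OF x j(1) i] j H by simp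
        show "finprod G (\<lambda>l. (x(j := x j \<otimes> x i)) l [^] (m(i := m i - m j)) l) I = \<one>"
          using finprod_pow_mult_update[OF fin x j(1) i _ le] j rel by simp
      qed (use i j in auto)
      then show ?thesis using j le by simp
    qed
  qed
qed

section \<open>Splitting off a cyclic direct factor\<close>

text \<open>Natural exponents suffice because orders are finite and positive: the inverse of a
  generator is its power with exponent \<open>ord (x i) - 1\<close>. The Euclidean argument above is
  about such exponents.\<close>

lemma generate_image_finprod_pow:
  assumes finG: "finite (carrier G)" and fin: "finite I" and x: "x \<in> I \<rightarrow> carrier G"
    and "z \<in> generate G (x ` I)"
  obtains m :: "'i \<Rightarrow> nat" where "z = finprod G (\<lambda>l. x l [^] m l) I"
proof -
  have single: "finprod G (\<lambda>l. x l [^] (if l = i then n else 0 :: nat)) I = x i [^] n"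
    if i: "i \<in> I" for i and n :: nat
  proof -
    have "finprod G (\<lambda>l. x l [^] (if l = i then n else 0 :: nat)) I
        = x i [^] n \<otimes> finprod G (\<lambda>l. x l [^] (if l = i then n else 0 :: nat)) (I - {i})"
      using finprod_remove[OF fin i, of "\<lambda>l. x l [^] (if l = i then n else 0 :: nat)"] x
      by (auto simp: Pi_def)
    also have "finprod G (\<lambda>l. x l [^] (if l = i then n else 0 :: nat)) (I - {i}) = \<one>"
      by (intro finprod_one_eqI) auto
    finally show ?thesis using x i by (auto simp: Pi_def)
  qed
  have "\<exists>m :: 'i \<Rightarrow> nat. z = finprod G (\<lambda>l. x l [^] m l) I"
    using assms(4)
  proof (induction rule: generate.induct)
    case one
    show ?case by (rule exI[of _ "\<lambda>_. 0"]) simp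
  next
    case (incl h)
    then obtain i where i: "i \<in> I" "h = x i" by blast
    then show ?case using single[OF i(1), of 1] x by (metis PiE nat_pow_eone)
  next
    case (inv h)
    then obtain i where i: "i \<in> I" "h = x i" by blast
    have xi: "x i \<in> carrier G" using x i by auto
    have "x i [^] (ord (x i) - 1) \<otimes> x i = x i [^] (Suc (ord (x i) - 1))" by simp
    also have "Suc (ord (x i) - 1) = ord (x i)" using ord_ge_1[OF finG xi] by simp
    finally have "x i [^] (ord (x i) - 1) \<otimes> x i = \<one>" using xi by (simp add: pow_ord_eq_1)
    then have "inv h = x i [^] (ord (x i) - 1)" using xi i by (metis inv_equality nat_pow_closed)
    then show ?case using single[OF i(1)] by metis
  next
    case (eng h1 h2)
    then obtain m k :: "'i \<Rightarrow> nat" where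
      "h1 = finprod G (\<lambda>l. x l [^] m l) I" "h2 = finprod G (\<lambda>l. x l [^] k l) I" by blast
    then have "h1 \<otimes> h2 = finprod G (\<lambda>l. x l [^] m l \<otimes> x l [^] k l) I"
      using x by (subst finprod_multf) (auto simp: Pi_def)
    also have "\<dots> = finprod G (\<lambda>l. x l [^] (m l + k l)) I"
      using x by (intro finprod_cong') (auto simp: Pi_def nat_pow_mult)
    finally show ?case by (rule exI[of _ "\<lambda>l. m l + k l"])
  qed
  then show ?thesis using that by blast
qed

text \<open>Choose the family and the index so that the order of the member is least. A smaller
  positive power of it lying in the subgroup generated by the others would yield a relation whose
  exponent at \<open>i\<close> is below this minimum. Since \<open>I\<close> is fixed, the number of
  generators does not grow.\<close>

lemma generating_family_direct_factor:
  assumes finG: "finite (carrier G)" and fin: "finite I" and ne: "I \<noteq> {}"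
    and x0: "x0 \<in> I \<rightarrow> carrier G"
  obtains x i where "x \<in> I \<rightarrow> carrier G" "generate G (x ` I) = generate G (x0 ` I)" "i \<in> I"
    "\<And>a. \<lbrakk>0 < a; a < ord (x i)\<rbrakk> \<Longrightarrow> x i [^] a \<notin> generate G (x ` (I - {i}))"
proof -
  define H where "H = generate G (x0 ` I)"
  let ?P = "\<lambda>(x, i). x \<in> I \<rightarrow> carrier G \<and> generate G (x ` I) = H \<and> i \<in> I"
  obtain i0 where "i0 \<in> I" using ne by blast
  then have "?P (x0, i0)" using x0 H_def by simp
  \<comment> \<open>Minimising jointly over families and indices bounds the orders of all members of
    all generating families, as \<open>relation_exponent_ge_min_ord\<close> demands.\<close>
  then obtain p where p: "?P p" "\<And>q. ?P q \<Longrightarrow> ord (fst p (snd p)) \<le> ord (fst q (snd q))"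
    using ex_has_least_nat[of ?P "(x0, i0)" "\<lambda>p. ord (fst p (snd p))"] by blast
  obtain x i where [simp]: "p = (x, i)" by fastforce
  have x: "x \<in> I \<rightarrow> carrier G" and xH: "generate G (x ` I) = H" and i: "i \<in> I" using p(1) by auto
  have min: "ord (x i) \<le> ord (y j)" if "y \<in> I \<rightarrow> carrier G" "generate G (y ` I) = H" "j \<in> I" for y j
    using p(2)[of "(y, j)"] that by simp
  have c: "x i \<in> carrier G" using x i by auto
  have rest: "x \<in> I - {i} \<rightarrow> carrier G" using x by auto
  have sub: "subgroup (generate G (x ` (I - {i}))) G"
    using rest by (intro generate_is_subgroup) auto
  have "x i [^] a \<notin> generate G (x ` (I - {i}))" if a: "0 < a" "a < ord (x i)" for a
  proof
    assume "x i [^] a \<in> generate G (x ` (I - {i}))"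
    \<comment> \<open>Passing to the inverse turns the membership into a relation whose exponents
      are all natural numbers: \<open>a\<close> at \<open>i\<close>, and \<open>m\<close>
      elsewhere.\<close>
    then have "inv (x i [^] a) \<in> generate G (x ` (I - {i}))"
      using sub by (rule subgroup.m_inv_closed[rotated])
    then obtain m :: "_ \<Rightarrow> nat" where m: "inv (x i [^] a) = finprod G (\<lambda>l. x l [^] m l) (I - {i})"
      using generate_image_finprod_pow[OF finG _ rest] fin by blast
    let ?k = "m(i := a)"
    have "finprod G (\<lambda>l. x l [^] ?k l) I
        = x i [^] a \<otimes> finprod G (\<lambda>l. x l [^] ?k l) (I - {i})"
      using finprod_remove[OF fin i, of "\<lambda>l. x l [^] ?k l"] x c by (auto simp: Pi_def)
    also have "finprod G (\<lambda>l. x l [^] ?k l) (I - {i}) = finprod G (\<lambda>l. x l [^] m l) (I - {i})"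
      using rest by (intro finprod_cong') (auto simp: Pi_def)
    also have "x i [^] a \<otimes> \<dots> = \<one>" using c by (simp flip: m)
    finally have rel: "finprod G (\<lambda>l. x l [^] ?k l) I = \<one>" .
    have "ord (x i) \<le> ?k i"
      by (rule relation_exponent_ge_min_ord[OF fin _ x xH rel i]) (use min a in auto)
    then show False using a by simp
  qed
  then show ?thesis using that[OF x _ i] xH H_def by blast
qed

section \<open>Listing a group block by block\<close>

text \<open>Induction on the number of generators. The closing difference is claimed only for
  nonempty \<open>I\<close>: for empty \<open>I\<close> the listing is a single element and
  \<open>D\<close> is empty, while the closing difference would be \<open>\<one>\<close>.\<close>

lemma exists_listing_few_differences:
  assumes finG: "finite (carrier G)" and fin: "finite I"
    and "x \<in> I \<rightarrow> carrier G"
  shows "\<exists>f n D. 0 < n \<and> bij_betw f {..<n} (generate G (x ` I)) \<and> finite D \<and> card D \<le> card I \<and>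
    (\<forall>k. Suc k < n \<longrightarrow> f (Suc k) \<otimes> inv (f k) \<in> D) \<and> (I \<noteq> {} \<longrightarrow> f 0 \<otimes> inv (f (n - 1)) \<in> D)"
  using assms(2,3)
proof (induction "card I" arbitrary: I x)
  case 0
  then have "I = {}" by simp
  moreover have "bij_betw (\<lambda>_. \<one>) {..<1 :: nat} {\<one>}" by (simp add: bij_betw_def lessThan_Suc)
  ultimately show ?case
    by (intro exI[of _ "\<lambda>_. \<one>"] exI[of _ "1 :: nat"] exI[of _ "{}"]) (simp add: generate_empty)
next
  case (Suc c)
  have "I \<noteq> {}" using Suc.hyps by auto
  then obtain y i where y: "y \<in> I \<rightarrow> carrier G" and yx: "generate G (y ` I) = generate G (x ` I)"
    and i: "i \<in> I"
    and direct: "\<And>a. \<lbrakk>0 < a; a < ord (y i)\<rbrakk> \<Longrightarrow> y i [^] a \<notin> generate G (y ` (I - {i}))"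
    using generating_family_direct_factor[OF finG Suc.prems(1) _ Suc.prems(2)] by metis
  define s where "s = y i"
  define m where "m = ord s"
  define H where "H = generate G (y ` (I - {i}))"
  define K where "K = generate G (y ` I)"
  have s: "s \<in> carrier G" using y i s_def by auto
  have m: "0 < m" using ord_ge_1[OF finG s] m_def by simp
  have rest: "y \<in> I - {i} \<rightarrow> carrier G" using y by auto
  have subH: "subgroup H G" unfolding H_def using rest by (intro generate_is_subgroup) auto
  have subK: "subgroup K G" unfolding K_def using y by (intro generate_is_subgroup) auto
  have HK: "H \<subseteq> K" unfolding H_def K_def by (intro mono_generate) auto
  have sK: "s \<in> K" unfolding K_def s_def using i by (blast intro: generate.incl)
  have cI: "c = card (I - {i})" using Suc.hyps(2) i Suc.prems by simp
  obtain f n D where n: "0 < n" and f: "bij_betw f {..<n} H" and D: "finite D" "card D \<le> c"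
    and step: "\<And>k. Suc k < n \<Longrightarrow> f (Suc k) \<otimes> inv (f k) \<in> D"
    using Suc.hyps(1)[OF cI _ rest] Suc.prems(1) cI unfolding H_def by auto
  have fH: "f k \<in> H" if "k < n" for k using f that by (auto simp: bij_betw_def)
  have fc: "f k \<in> carrier G" if "k < n" for k using fH[OF that] subH by (meson subgroup.mem_carrier)
  \<comment> \<open>Index \<open>k\<close> is position \<open>k mod n\<close> within block
    \<open>k div n\<close>, where block number \<open>j\<close> is the coset of \<open>H\<close>
    shifted by \<open>s [^] j\<close>. The difference \<open>t\<close> leads from the end of a block
    to the start of the next.\<close>
  define g where "g = (\<lambda>k. f (k mod n) \<otimes> s [^] (k div n))"
  define t where "t = f 0 \<otimes> s \<otimes> inv (f (n - 1))"
  have gc: "g k \<in> carrier G" for k unfolding g_def using fc s n by simp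
  have g_step: "g (Suc k) \<otimes> inv (g k) \<in> insert t D" for k
  proof -
    have cancel: "(a \<otimes> u) \<otimes> inv (b \<otimes> u) = a \<otimes> inv b"
      if "a \<in> carrier G" "b \<in> carrier G" "u \<in> carrier G" for a b u
      using that by (simp add: inv_mult_group m_assoc flip: m_assoc[of u "inv u"])
    show ?thesis
    proof (cases "Suc (k mod n) = n")
      \<comment> \<open>At a block boundary both elements carry the factor
        \<open>s [^] (k div n)\<close>; it cancels, so the difference is the same for every
        block.\<close>
      case True
      then have "g (Suc k) = (f 0 \<otimes> s) \<otimes> s [^] (k div n)"
        unfolding g_def using fc[OF n] s
        by (simp add: mod_Suc div_Suc m_ac)
      moreover have "g k = f (n - 1) \<otimes> s [^] (k div n)"
        unfolding g_def using True by (metis diff_Suc_1)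
      ultimately have "g (Suc k) \<otimes> inv (g k) = t"
        unfolding t_def using fc[of 0] fc[of "n - 1"] n s by (simp add: cancel)
      then show ?thesis by simp
    next
      case False
      then have lt: "Suc (k mod n) < n" using n by (simp add: Suc_lessI)
      then have "g (Suc k) = f (Suc (k mod n)) \<otimes> s [^] (k div n)"
        unfolding g_def by (simp add: mod_Suc div_Suc)
      then have "g (Suc k) \<otimes> inv (g k) = f (Suc (k mod n)) \<otimes> inv (f (k mod n))"
        unfolding g_def using fc lt s n by (simp add: cancel)
      then show ?thesis using step[OF lt] by simp
    qed
  qed
  \<comment> \<open>As \<open>g_step\<close> holds for every \<open>k\<close>, it also covers the
    step to index \<open>n * m\<close>, where \<open>g\<close> is back at \<open>g 0\<close> because
    \<open>s\<close> has order \<open>m\<close>.\<close>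
  have closing: "g 0 \<otimes> inv (g (n * m - 1)) \<in> insert t D"
  proof -
    have "g (n * m) = g 0" unfolding g_def using n s by (simp add: m_def pow_ord_eq_1)
    then show ?thesis using g_step[of "n * m - 1"] n m by simp
  qed
  have inj: "inj_on g {..<n * m}"
  proof -
    \<comment> \<open>If equal values lay in different blocks, dividing would put a power of
      \<open>s\<close> with exponent strictly between 0 and \<open>m\<close> into \<open>H\<close>.
      By symmetry in \<open>k\<close> and \<open>l\<close> the block numbers agree.\<close>
    have le: "k div n \<le> l div n" if kl: "k < n * m" "l < n * m" and eq: "g k = g l" for k l
    proof (rule ccontr)
      assume "\<not> ?thesis"
      then have lt: "l div n < k div n" by simp
      define a where "a = k div n - l div n"
      have "k div n < m" using kl by (simp add: less_mult_imp_div_less mult.commute)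
      then have a: "0 < a" "a < ord (y i)" using lt unfolding a_def m_def s_def by auto
      have "f (k mod n) \<otimes> (s [^] a \<otimes> s [^] (l div n)) = f (l mod n) \<otimes> s [^] (l div n)"
        using eq s lt unfolding g_def a_def by (simp add: nat_pow_mult)
      then have "(f (k mod n) \<otimes> s [^] a) \<otimes> s [^] (l div n) = f (l mod n) \<otimes> s [^] (l div n)"
        using fc n s by (simp add: m_assoc)
      then have "f (k mod n) \<otimes> s [^] a = f (l mod n)"
        using fc n s by (simp add: right_cancel)
      then have "s [^] a = inv (f (k mod n)) \<otimes> f (l mod n)"
        using fc n s by (metis inv_solve_left mod_less_divisor nat_pow_closed)
      also have "\<dots> \<in> H"
        using fH n subH by (simp add: subgroup.m_closed subgroup.m_inv_closed)
      finally show False using direct[OF a] unfolding H_def s_def by simp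
    qed
    show ?thesis
    proof (rule inj_onI)
      fix k l assume kl: "k \<in> {..<n * m}" "l \<in> {..<n * m}" and eq: "g k = g l"
      have d: "k div n = l div n" using le[of k l] le[of l k] kl eq by simp
      then have "f (k mod n) = f (l mod n)"
        using eq fc n s unfolding g_def by (simp add: right_cancel)
      then have "k mod n = l mod n" using f n by (auto simp: bij_betw_def inj_on_def)
      then show "k = l" using d by (metis div_mult_mod_eq)
    qed
  qed
  have "g ` {..<n * m} = K"
  proof (intro equalityI subsetI)
    fix z assume "z \<in> g ` {..<n * m}"
    then obtain k where "z = f (k mod n) \<otimes> s [^] (k div n)" unfolding g_def by blast
    moreover have "s [^] (k div n) \<in> K" for k :: nat
      using sK subK by (simp add: subgroup_nat_pow_closed)
    ultimately show "z \<in> K" using fH n HK subK by (meson mod_less_divisor subgroup.m_closed subsetD)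
  next
    fix z assume "z \<in> K"
    then obtain e :: "_ \<Rightarrow> nat" where e: "z = finprod G (\<lambda>l. y l [^] e l) I"
      unfolding K_def using generate_image_finprod_pow[OF finG Suc.prems(1) y] by blast
    define h where "h = finprod G (\<lambda>l. y l [^] e l) (I - {i})"
    have yH: "y l [^] e l \<in> H" if "l \<in> I - {i}" for l
      using that subH unfolding H_def by (simp add: subgroup_nat_pow_closed generate.incl)
    have hH: "h \<in> H"
      unfolding h_def using yH
      by (intro finprod_in_subgroup[OF subH])
    have zh: "z = s [^] e i \<otimes> h"
      unfolding e h_def s_def using y i Suc.prems(1) by (intro finprod_remove) (auto simp: Pi_def)
    obtain k where k: "k < n" "h = f k" using hH f by (auto simp: bij_betw_def)
    \<comment> \<open>Reducing the exponent modulo the order of \<open>s\<close> gives a valid block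
      number; position \<open>k\<close> in block \<open>j\<close> has index
      \<open>n * j + k\<close>.\<close>
    define j where "j = e i mod m"
    have j: "j < m" using m j_def by simp
    have "s [^] e i = s [^] j"
      using s unfolding j_def m_def by (simp add: pow_mod_ord)
    then have "z = g (n * j + k)"
      using zh k fc s unfolding g_def by (simp add: m_comm)
    moreover have "n * j + k < n * m"
    proof -
      have "n * j + k < n * Suc j" using k by simp
      also have "\<dots> \<le> n * m" using j by (intro mult_le_mono2) simp
      finally show ?thesis .
    qed
    ultimately show "z \<in> g ` {..<n * m}" by blast
  qed
  then have "bij_betw g {..<n * m} (generate G (x ` I))"
    using inj unfolding bij_betw_def K_def yx by simp
  moreover have "card (insert t D) \<le> card I"
    using D Suc.hyps(2) by (metis Suc_le_mono card_insert_le_m1 card_insert_if le_Suc_eq)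
  ultimately show ?case
    using n m D g_step closing
    by (intro exI[of _ g] exI[of _ "n * m"] exI[of _ "insert t D"]) auto
qed

section \<open>From Hamiltonian cycles to generating sets and back\<close>

text \<open>Differences telescope: the quotient of any listed element by the first one is a product
  of differences. As every group element is listed, these quotients exhaust the group.\<close>

lemma generate_differences:
  assumes "xs \<in> hamiltonian_cycles G"
  shows "differences G xs \<subseteq> carrier G" "generate G (differences G xs) = carrier G"
proof -
  have set: "set xs = carrier G" using assms by (simp add: hamiltonian_cycles_def)
  have n: "0 < length xs" using set by fastforce
  have c: "xs ! i \<in> carrier G" if "i < length xs" for i using that set nth_mem by blast
  show sub: "differences G xs \<subseteq> carrier G"
    unfolding differences_def cycle_arcs_def using c n by auto
  let ?K = "generate G (differences G xs)"
  have K: "subgroup ?K G" using sub by (rule generate_is_subgroup)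
  have from0: "xs ! i \<otimes> inv (xs ! 0) \<in> ?K" if "i < length xs" for i
    using that
  proof (induction i)
    case 0
    then show ?case using c K by (simp add: subgroup.one_closed)
  next
    case (Suc i)
    have "xs ! Suc i \<otimes> inv (xs ! i) \<in> differences G xs"
      unfolding differences_def cycle_arcs_def using Suc.prems
      by (force intro: exI[of _ i])
    then have "(xs ! Suc i \<otimes> inv (xs ! i)) \<otimes> (xs ! i \<otimes> inv (xs ! 0)) \<in> ?K"
      using Suc K by (simp add: generate.incl subgroup.m_closed)
    moreover have "(xs ! Suc i \<otimes> inv (xs ! i)) \<otimes> (xs ! i \<otimes> inv (xs ! 0)) = xs ! Suc i \<otimes> inv (xs ! 0)"
      using c[of "Suc i"] c[of i] c[of 0] Suc.prems n
      by (simp add: m_assoc flip: m_assoc[of "inv (xs ! i)"])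
    ultimately show ?case by simp
  qed
  show "?K = carrier G"
  proof
    show "?K \<subseteq> carrier G" using K by (rule subgroup.subset)
    show "carrier G \<subseteq> ?K"
    proof
      fix a assume a: "a \<in> carrier G"
      \<comment> \<open>The listed element to look up is the one whose quotient by
        \<open>xs ! 0\<close> is \<open>a\<close>.\<close>
      then have "a \<otimes> xs ! 0 \<in> set xs" using c n set by simp
      then obtain i where "i < length xs" "xs ! i = a \<otimes> xs ! 0" by (auto simp: in_set_conv_nth)
      then have "(a \<otimes> xs ! 0) \<otimes> inv (xs ! 0) \<in> ?K" using from0 by metis
      then show "a \<in> ?K" using a c[OF n] by (simp add: m_assoc)
    qed
  qed
qed

text \<open>The set \<open>S\<close> becomes a family indexed by itself. Nontriviality makes
  \<open>S\<close> nonempty, which supplies the closing difference, and makes the listing longer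
  than 1, which rules out loops.\<close>

lemma exists_hamiltonian_cycle_few_differences:
  assumes finG: "finite (carrier G)" and nontriv: "carrier G \<noteq> {\<one>}"
    and S: "S \<subseteq> carrier G" "finite S" "generate G S = carrier G"
  obtains xs where "xs \<in> hamiltonian_cycles G" "card (differences G xs) \<le> card S"
proof -
  have "S \<noteq> {}" using S nontriv generate_empty by auto
  moreover have "(\<lambda>a. a) \<in> S \<rightarrow> carrier G" using S by auto
  ultimately obtain f n D where n: "0 < n" and f: "bij_betw f {..<n} (carrier G)"
    and D: "finite D" "card D \<le> card S"
    and step: "\<And>k. Suc k < n \<Longrightarrow> f (Suc k) \<otimes> inv (f k) \<in> D"
    and closing: "f 0 \<otimes> inv (f (n - 1)) \<in> D"
    using exists_listing_few_differences[OF finG S(2), of "\<lambda>a. a"] S(3) by auto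
  define xs where "xs = map f [0..<n]"
  have set: "set xs = carrier G" and dist: "distinct xs"
    using f by (auto simp: xs_def bij_betw_def distinct_map atLeast0LessThan)
  have n1: "1 < n"
  proof (rule ccontr)
    assume "\<not> 1 < n"
    then have "n = 1" using n by simp
    then have "carrier G = {f 0}" using f by (simp add: bij_betw_def lessThan_Suc)
    then show False using nontriv one_closed by auto
  qed
  have "cycle_arcs xs \<subseteq> complete_digraph_arcs (carrier G)"
  proof -
    have "f i \<noteq> f (Suc i mod n)" if "i < n" for i
    proof -
      have "i \<noteq> Suc i mod n" using n1 that by (auto simp: mod_Suc)
      then show ?thesis using f that n by (auto simp: bij_betw_def inj_on_def)
    qed
    moreover have "f i \<in> carrier G" if "i < n" for i using f that by (auto simp: bij_betw_def)
    ultimately show ?thesis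
      unfolding cycle_arcs_def complete_digraph_arcs_def xs_def using n by auto
  qed
  then have "xs \<in> hamiltonian_cycles G" using set dist by (simp add: hamiltonian_cycles_def)
  moreover have "differences G xs \<subseteq> D"
  proof -
    have "f (Suc i mod n) \<otimes> inv (f i) \<in> D" if "i < n" for i
    proof (cases "Suc i = n")
      case True
      then show ?thesis using closing by auto
    next
      case False
      then show ?thesis using step[of i] that by simp
    qed
    then show ?thesis unfolding differences_def cycle_arcs_def xs_def using n by auto
  qed
  then have "card (differences G xs) \<le> card S" using D card_mono le_trans by blast
  ultimately show ?thesis by (rule that)
qed

end

theorem theorem1:
  fixes G (structure)
  assumes "comm_group G" and "finite (carrier G)"
  shows "d_min G = group_rank G"
proof -
  interpret comm_group G by fact
  let ?Q = "\<lambda>k. \<exists>S. S \<subseteq> carrier G \<and> finite S \<and> card S = k \<and> generate G S = carrier G"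
  \<comment> \<open>The whole carrier generates the group, so the minimum defining
    \<open>group_rank\<close> is attained.\<close>
  have "?Q (card (carrier G))"
    using assms(2) generate_incl[of "carrier G"] generate.incl[of _ "carrier G" G] by blast
  then have "?Q (group_rank G)" unfolding group_rank_def by (rule LeastI)
  then obtain S where S: "S \<subseteq> carrier G" "finite S" "card S = group_rank G" "generate G S = carrier G"
    by blast
  have lower: "group_rank G \<le> card (differences G xs)" if "xs \<in> hamiltonian_cycles G" for xs
    unfolding group_rank_def using generate_differences[OF that] assms(2)
    by (intro Least_le) (blast intro: finite_subset)
  show ?thesis
  proof (cases "carrier G = {\<one>}")
    case True
    have "group_rank G \<le> 0"
      unfolding group_rank_def using True
      by (intro Least_le exI[of _ "{}"]) (simp add: generate_empty)
    \<comment> \<open>On one vertex the only closed listing uses a loop, which is not an arc;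
      \<open>d_min\<close> then takes its default value 0, matching the empty generating
      set.\<close>
    moreover have "hamiltonian_cycles G = {}"
    proof -
      have False if "xs \<in> hamiltonian_cycles G" for xs
      proof -
        have "xs \<noteq> []" using that True by (auto simp: hamiltonian_cycles_def)
        then have "cycle_arcs xs \<noteq> {}" by (auto simp: cycle_arcs_def)
        moreover have "cycle_arcs xs \<subseteq> complete_digraph_arcs {\<one>}"
          using that True by (simp add: hamiltonian_cycles_def)
        ultimately show False by (auto simp: complete_digraph_arcs_def)
      qed
      then show ?thesis by blast
    qed
    ultimately show ?thesis by (simp add: d_min_def)
  next
    case False
    obtain xs where xs: "xs \<in> hamiltonian_cycles G" "card (differences G xs) \<le> card S"
      using exists_hamiltonian_cycle_few_differences[OF assms(2) False S(1,2,4)] by blast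
    then have "card (differences G xs) = group_rank G" using lower[of xs] S(3) by simp
    then have "(LEAST k. \<exists>xs\<in>hamiltonian_cycles G. k = card (differences G xs)) = group_rank G"
      using xs(1) lower by (intro Least_equality bexI[of _ xs]) auto
    then show ?thesis unfolding d_min_def using xs by auto
  qed
qed

end
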